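(* Let $X$ be a topological space and let $\mathcal{F}$ be a subset of $\mathbb{H}_{ft}(X)$ which is bounded from above, i.e. there is $\psi\in\mathbb{H}_{ft}(X)$ with $f\le\psi$ for all $f\in\mathcal{F}$. Then there exists $u\in\mathbb{H}_{ft}(X)$ such that $u=\sup\mathcal{F}$, where the supremum is taken in the partially ordered set $(\mathbb{H}_{ft}(X),\le)$.
   Context: Let $\overline{\mathbb{R}}=\mathbb{R}\cup\{\pm\infty\}$ and let $\mathbb{I}\overline{\mathbb{R}}=\{[\underline a,\overline a]:\underline a,\overline a\in\overline{\mathbb{R}},\ \underline a\le\overline a\}$ be the set of closed intervals $[\underline a,\overline a]=\{z\in\overline{\mathbb R}:\underline a\le z\le\overline a\}$, partially ordered by $[\underline a,\overline a]\le[\underline b,\overline b]\iff \underline a\le\underline b$ and $\overline a\le\overline b$. A point $x\in\overline{\mathbb{R}}$ is identified with $[x,x]$. For a topological space $X$ let $\mathbb{A}(X)$ be the set of all functions $f:X\to\mathbb{I}\overline{\mathbb{R}}$, ordered pointwise: $f\le g\iff f(x)\le g(x)$ for all $x\in X$. Let $\mathcal{A}(X)\subset\mathbb{A}(X)$ be the set of functions $X\to\overline{\mathbb{R}}$. With $\mathcal{V}_x$ the set of neighborhoods of $x$, define for $f\in\mathbb{A}(X)$ the functions $I(f),S(f)\in\mathcal{A}(X)$ and $F(f)\in\mathbb{A}(X)$ by $I(f)(x)=\sup_{V\in\mathcal{V}_x}\inf\{z\in f(y):y\in V\}$, $S(f)(x)=\inf_{V\in\mathcal{V}_x}\sup\{z\in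 f(y):y\in V\}$, $F(f)(x)=[I(f)(x),S(f)(x)]$. A function $f\in\mathbb{A}(X)$ is Hausdorff continuous (H-continuous) if for every $g\in\mathbb{A}(X)$ with $g(x)\subseteq f(x)$ for all $x\in X$ one has $F(g)(x)=f(x)$ for all $x\in X$. $\mathbb{H}(X)$ is the set of all H-continuous functions on $X$, and $\mathbb{H}_{ft}(X)=\{f\in\mathbb{H}(X): f(x)\subseteq\mathbb{R}\text{ for all }x\in X\}$, with the order induced from $\mathbb{A}(X)$.
   Formalization: The set F is assumed nonempty (and X is nonempty): for empty F the supremum would be a least element of H_ft(X), which does not exist because all real constants belong to H_ft(X). *)

theory Defs
  imports
    "HOL-Library.Interval"
    "HOL-Library.Extended_Real"
    "HOL-Algebra.Lattice"
begin

text \<open>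
  Closed intervals of extended reals are elements of \<open>ereal interval\<close>.  The relation \<open>\<le>\<close> that
  the library declares on intervals is inclusion; the order used here compares lower bounds and
  upper bounds separately, so it gets its own name.
\<close>

definition interval_le :: "ereal interval \<Rightarrow> ereal interval \<Rightarrow> bool"  (infix \<open>\<le>\<^sub>I\<close> 50) where
  "a \<le>\<^sub>I b \<longleftrightarrow> lower a \<le> lower b \<and> upper a \<le> upper b"

definition fun_interval_le ::
    "('a \<Rightarrow> ereal interval) \<Rightarrow> ('a \<Rightarrow> ereal interval) \<Rightarrow> bool"  (infix \<open>\<le>\<^sub>F\<close> 50) where
  "f \<le>\<^sub>F g \<longleftrightarrow> (\<forall>x. f x \<le>\<^sub>I g x)"

text \<open>Neighborhoods need not be open.\<close>

definition neighborhoods :: "'a::topological_space \<Rightarrow> 'a set set" where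
  "neighborhoods x = {V. \<exists>U. open U \<and> x \<in> U \<and> U \<subseteq> V}"

text \<open>
  The lower and upper Baire operators \<open>I\<close> and \<open>S\<close>, and the graph completion operator \<open>F\<close>.
\<close>

definition lower_baire :: "('a::topological_space \<Rightarrow> ereal interval) \<Rightarrow> 'a \<Rightarrow> ereal" where
  "lower_baire f x = (SUP V\<in>neighborhoods x. Inf (\<Union>y\<in>V. set_of (f y)))"

definition upper_baire :: "('a::topological_space \<Rightarrow> ereal interval) \<Rightarrow> 'a \<Rightarrow> ereal" where
  "upper_baire f x = (INF V\<in>neighborhoods x. Sup (\<Union>y\<in>V. set_of (f y)))"

definition graph_completion ::
    "('a::topological_space \<Rightarrow> ereal interval) \<Rightarrow> 'a \<Rightarrow> ereal interval" where
  "graph_completion f x = Interval (lower_baire f x, upper_baire f x)"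

text \<open>
  The abstraction function \<open>Interval\<close> is meaningful only on pairs \<open>(a, b)\<close> with \<open>a \<le> b\<close>.
\<close>

lemma lower_baire_le_upper_baire: "lower_baire f x \<le> upper_baire f x"
proof -
  have "Inf (\<Union>y\<in>V. set_of (f y)) \<le> Sup (\<Union>y\<in>W. set_of (f y))"
    if "V \<in> neighborhoods x" "W \<in> neighborhoods x" for V W
  proof -
    have "x \<in> V" "x \<in> W"
      using that by (auto simp: neighborhoods_def)
    moreover have "lower (f x) \<in> set_of (f x)"
      by (simp add: set_of_eq)
    ultimately have "lower (f x) \<in> (\<Union>y\<in>V. set_of (f y))" "lower (f x) \<in> (\<Union>y\<in>W. set_of (f y))"
      by blast+
    then show ?thesis
      by (meson Inf_lower Sup_upper order_trans)
  qed
  then show ?thesis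
    unfolding lower_baire_def upper_baire_def by (intro SUP_least INF_greatest)
qed

lemma lower_graph_completion [simp]: "lower (graph_completion f x) = lower_baire f x"
  and upper_graph_completion [simp]: "upper (graph_completion f x) = upper_baire f x"
  by (simp_all add: graph_completion_def lower.rep_eq upper.rep_eq Interval_inverse
      lower_baire_le_upper_baire)

definition hausdorff_continuous :: "('a::topological_space \<Rightarrow> ereal interval) \<Rightarrow> bool" where
  "hausdorff_continuous f \<longleftrightarrow>
    (\<forall>g. (\<forall>x. set_of (g x) \<subseteq> set_of (f x)) \<longrightarrow> (\<forall>x. graph_completion g x = f x))"

definition finite_hausdorff_continuous :: "('a::topological_space \<Rightarrow> ereal interval) set"
    (\<open>\<H>\<^sub>f\<^sub>t\<close>) where
  "\<H>\<^sub>f\<^sub>t = {f. hausdorff_continuous f \<and> (\<forall>x. set_of (f x) \<subseteq> range ereal)}"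

definition finite_hausdorff_continuous_order :: "('a::topological_space \<Rightarrow> ereal interval) gorder"
    (\<open>\<H>\<^sub>f\<^sub>t'_order\<close>) where
  "\<H>\<^sub>f\<^sub>t_order = \<lparr>carrier = \<H>\<^sub>f\<^sub>t, eq = (=), le = (\<le>\<^sub>F)\<rparr>"

lemma partial_order_finite_hausdorff_continuous: "partial_order \<H>\<^sub>f\<^sub>t_order"
  by unfold_locales
    (auto simp: finite_hausdorff_continuous_order_def fun_interval_le_def interval_le_def
      interval_eq_iff fun_eq_iff intro: order_trans order_antisym)

end

theory Submission
  imports Defs
begin

text \<open>
  Both operators of the theory are envelopes of extended-real functions: for interval functions,
  \<open>I\<close> is the lower semicontinuous envelope of the lower bound and \<open>S\<close> the upper semicontinuous
  envelope of the upper bound.  Each envelope is monotone and idempotent, the lower one deflates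
  and the upper one inflates.  Squeezing \<open>g \<subseteq> f\<close> between the two bounds of \<open>f\<close> shows that \<open>f\<close> is
  H-continuous exactly when its bounds determine each other: \<open>upper f = S (lower f)\<close> and
  \<open>lower f = I (upper f)\<close>.

  Let \<open>\<phi>\<close> be the pointwise supremum of the lower bounds of the members of \<open>\<F>\<close>.  The interval
  function \<open>u = [I (S \<phi>), S \<phi>]\<close> is the supremum.  It is H-continuous because \<open>\<phi>\<close>, being a supremum
  of lower semicontinuous functions, satisfies \<open>\<phi> = I \<phi> \<le> I (S \<phi>)\<close>, so that \<open>S (I (S \<phi>))\<close> is
  squeezed between \<open>S \<phi>\<close> and \<open>S (S \<phi>) = S \<phi>\<close>.  Since H-continuous functions are compared by
  comparing their lower bounds alone (apply \<open>S\<close>), \<open>u\<close> is an upper bound; and an H-continuous upper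
  bound \<open>g\<close> has \<open>\<phi> \<le> lower g\<close>, whence \<open>S \<phi> \<le> upper g\<close> by applying \<open>S\<close> and
  \<open>I (S \<phi>) \<le> lower g\<close> by applying \<open>I\<close>.  Finally, \<open>u\<close> is finite because it lies above some member
  of \<open>\<F>\<close> and below a finite bound of \<open>\<F>\<close>.
\<close>

section \<open>Semicontinuous envelopes\<close>

definition lsc_envelope ::
    "('a::topological_space \<Rightarrow> 'b::complete_lattice) \<Rightarrow> 'a \<Rightarrow> 'b" where
  "lsc_envelope \<phi> x = (SUP V\<in>neighborhoods x. INF y\<in>V. \<phi> y)"

definition usc_envelope ::
    "('a::topological_space \<Rightarrow> 'b::complete_lattice) \<Rightarrow> 'a \<Rightarrow> 'b" where
  "usc_envelope \<phi> x = (INF V\<in>neighborhoods x. SUP y\<in>V. \<phi> y)"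

lemma mem_neighborhood: "V \<in> neighborhoods x \<Longrightarrow> x \<in> V"
  by (auto simp: neighborhoods_def)

lemma open_in_neighborhoods: "open U \<Longrightarrow> x \<in> U \<Longrightarrow> U \<in> neighborhoods x"
  by (auto simp: neighborhoods_def)

lemma lsc_envelope_le: "lsc_envelope \<phi> \<le> \<phi>"
  unfolding le_fun_def lsc_envelope_def by (meson INF_lower SUP_least mem_neighborhood)

lemma usc_envelope_ge: "\<phi> \<le> usc_envelope \<phi>"
  unfolding le_fun_def usc_envelope_def by (meson SUP_upper INF_greatest mem_neighborhood)

lemma lsc_envelope_mono: "\<phi> \<le> \<psi> \<Longrightarrow> lsc_envelope \<phi> \<le> lsc_envelope \<psi>"
  unfolding le_fun_def lsc_envelope_def by (intro allI SUP_mono' INF_mono') auto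

lemma usc_envelope_mono: "\<phi> \<le> \<psi> \<Longrightarrow> usc_envelope \<phi> \<le> usc_envelope \<psi>"
  unfolding le_fun_def usc_envelope_def by (intro allI INF_mono' SUP_mono') auto

text \<open>
  An open neighborhood of \<open>x\<close> is a neighborhood of each of its points, so a bound of \<open>\<phi>\<close> on it
  bounds the envelope on all of it.
\<close>

lemma lsc_envelope_idem: "lsc_envelope (lsc_envelope \<phi>) = lsc_envelope \<phi>"
proof (rule antisym[OF lsc_envelope_le], rule le_funI)
  fix x
  have "(INF y\<in>V. \<phi> y) \<le> lsc_envelope (lsc_envelope \<phi>) x" if V: "V \<in> neighborhoods x" for V
  proof -
    obtain U where U: "open U" "x \<in> U" "U \<subseteq> V"
      using V by (auto simp: neighborhoods_def)
    have "(INF y\<in>V. \<phi> y) \<le> (INF y\<in>U. \<phi> y)"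
      using U(3) by (rule INF_superset_mono) simp
    also have "\<dots> \<le> (INF y\<in>U. lsc_envelope \<phi> y)"
      unfolding lsc_envelope_def
      by (intro INF_greatest SUP_upper open_in_neighborhoods U(1))
    also have "\<dots> \<le> lsc_envelope (lsc_envelope \<phi>) x"
      unfolding lsc_envelope_def[of "lsc_envelope \<phi>"]
      by (intro SUP_upper open_in_neighborhoods U)
    finally show ?thesis .
  qed
  then show "lsc_envelope \<phi> x \<le> lsc_envelope (lsc_envelope \<phi>) x"
    unfolding lsc_envelope_def[of \<phi> x] by (rule SUP_least)
qed

lemma usc_envelope_idem: "usc_envelope (usc_envelope \<phi>) = usc_envelope \<phi>"
proof (rule antisym[OF _ usc_envelope_ge], rule le_funI)
  fix x
  have "usc_envelope (usc_envelope \<phi>) x \<le> (SUP y\<in>V. \<phi> y)" if V: "V \<in> neighborhoods x" for V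
  proof -
    obtain U where U: "open U" "x \<in> U" "U \<subseteq> V"
      using V by (auto simp: neighborhoods_def)
    have "usc_envelope (usc_envelope \<phi>) x \<le> (SUP y\<in>U. usc_envelope \<phi> y)"
      unfolding usc_envelope_def[of "usc_envelope \<phi>"]
      by (intro INF_lower open_in_neighborhoods U)
    also have "\<dots> \<le> (SUP y\<in>U. \<phi> y)"
      unfolding usc_envelope_def
      by (intro SUP_least INF_lower open_in_neighborhoods U(1))
    also have "\<dots> \<le> (SUP y\<in>V. \<phi> y)"
      using U(3) by (rule SUP_subset_mono) simp
    finally show ?thesis .
  qed
  then show "usc_envelope (usc_envelope \<phi>) x \<le> usc_envelope \<phi> x"
    unfolding usc_envelope_def[of \<phi> x] by (rule INF_greatest)
qed

lemma lsc_envelope_SUP: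
  assumes "\<And>i. i \<in> A \<Longrightarrow> lsc_envelope (\<phi> i) = \<phi> i"
  shows "lsc_envelope (SUP i\<in>A. \<phi> i) = (SUP i\<in>A. \<phi> i)"
proof (rule antisym[OF lsc_envelope_le], rule SUP_least)
  fix i assume "i \<in> A"
  then show "\<phi> i \<le> lsc_envelope (SUP i\<in>A. \<phi> i)"
    using lsc_envelope_mono[OF SUP_upper[of i A \<phi>]] assms by simp
qed

text \<open>
  A lower semicontinuous \<open>\<phi>\<close> stays below \<open>I (S \<phi>)\<close>, which therefore lies between \<open>\<phi>\<close> and
  \<open>S \<phi>\<close>; all three have the same upper envelope.
\<close>

lemma usc_lsc_usc_envelope:
  assumes "lsc_envelope \<phi> = \<phi>"
  shows "usc_envelope (lsc_envelope (usc_envelope \<phi>)) = usc_envelope \<phi>"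
proof (rule antisym)
  show "usc_envelope (lsc_envelope (usc_envelope \<phi>)) \<le> usc_envelope \<phi>"
    using usc_envelope_mono[OF lsc_envelope_le[of "usc_envelope \<phi>"]]
    by (simp add: usc_envelope_idem)
  have "\<phi> \<le> lsc_envelope (usc_envelope \<phi>)"
    using lsc_envelope_mono[OF usc_envelope_ge[of \<phi>]] assms by simp
  then show "usc_envelope \<phi> \<le> usc_envelope (lsc_envelope (usc_envelope \<phi>))"
    by (rule usc_envelope_mono)
qed

section \<open>Hausdorff continuity in terms of the bounds\<close>

lemma lower_baire_eq_lsc_envelope: "lower_baire f = lsc_envelope (lower \<circ> f)"
proof -
  have "Inf (\<Union>y\<in>V. set_of (f y)) = (INF y\<in>V. lower (f y))" for V
  proof (rule antisym)
    show "Inf (\<Union>y\<in>V. set_of (f y)) \<le> (INF y\<in>V. lower (f y))"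
      by (intro INF_greatest Inf_lower) (auto simp: set_of_eq)
    show "(INF y\<in>V. lower (f y)) \<le> Inf (\<Union>y\<in>V. set_of (f y))"
      by (intro Inf_greatest) (auto simp: set_of_eq intro: INF_lower2)
  qed
  then show ?thesis
    by (simp add: fun_eq_iff lower_baire_def lsc_envelope_def)
qed

lemma upper_baire_eq_usc_envelope: "upper_baire f = usc_envelope (upper \<circ> f)"
proof -
  have "Sup (\<Union>y\<in>V. set_of (f y)) = (SUP y\<in>V. upper (f y))" for V
  proof (rule antisym)
    show "(SUP y\<in>V. upper (f y)) \<le> Sup (\<Union>y\<in>V. set_of (f y))"
      by (intro SUP_least Sup_upper) (auto simp: set_of_eq intro!: bexI)
    show "Sup (\<Union>y\<in>V. set_of (f y)) \<le> (SUP y\<in>V. upper (f y))"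
      by (intro Sup_least) (auto simp: set_of_eq intro: SUP_upper2)
  qed
  then show ?thesis
    by (simp add: fun_eq_iff upper_baire_def usc_envelope_def)
qed

lemma graph_completion_eq_iff:
  "(\<forall>x. graph_completion g x = f x) \<longleftrightarrow>
    lsc_envelope (lower \<circ> g) = lower \<circ> f \<and> usc_envelope (upper \<circ> g) = upper \<circ> f"
  by (auto simp: interval_eq_iff fun_eq_iff
      simp flip: lower_baire_eq_lsc_envelope upper_baire_eq_usc_envelope)

text \<open>
  The two extreme selections \<open>g = lower f\<close> and \<open>g = upper f\<close> give the stated equations; conversely,
  the envelopes of any \<open>g \<subseteq> f\<close> are squeezed between those of the two bounds.
\<close>

lemma hausdorff_continuous_iff:
  "hausdorff_continuous f \<longleftrightarrow>
    usc_envelope (lower \<circ> f) = upper \<circ> f \<and> lsc_envelope (upper \<circ> f) = lower \<circ> f"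
proof (intro iffI conjI)
  assume f: "hausdorff_continuous f"
  have "\<forall>x. graph_completion (\<lambda>x. interval_of (lower (f x))) x = f x"
    using f unfolding hausdorff_continuous_def by (auto simp: set_of_eq)
  then show "usc_envelope (lower \<circ> f) = upper \<circ> f"
    by (simp add: graph_completion_eq_iff comp_def)
  have "\<forall>x. graph_completion (\<lambda>x. interval_of (upper (f x))) x = f x"
    using f unfolding hausdorff_continuous_def by (auto simp: set_of_eq)
  then show "lsc_envelope (upper \<circ> f) = lower \<circ> f"
    by (simp add: graph_completion_eq_iff comp_def)
next
  assume f: "usc_envelope (lower \<circ> f) = upper \<circ> f \<and> lsc_envelope (upper \<circ> f) = lower \<circ> f"
  have lsc: "lsc_envelope (lower \<circ> f) = lower \<circ> f"
    using f lsc_envelope_idem[of "upper \<circ> f"] by simp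
  have usc: "usc_envelope (upper \<circ> f) = upper \<circ> f"
    using f usc_envelope_idem[of "lower \<circ> f"] by simp
  show "hausdorff_continuous f"
    unfolding hausdorff_continuous_def
  proof (intro allI[where P = "\<lambda>g. _ g \<longrightarrow> _ g"] impI)
    fix g assume "\<forall>x. set_of (g x) \<subseteq> set_of (f x)"
    then have sub: "lower (f x) \<le> lower (g x)" "upper (g x) \<le> upper (f x)" for x
      by (simp_all add: set_of_eq)
    have "lower \<circ> f \<le> lower \<circ> g" "lower \<circ> g \<le> upper \<circ> f"
      "lower \<circ> f \<le> upper \<circ> g" "upper \<circ> g \<le> upper \<circ> f"
      using sub order_trans[OF lower_le_upper sub(2)] order_trans[OF sub(1) lower_le_upper]
      by (auto simp: le_fun_def)
    then have "lsc_envelope (lower \<circ> g) = lower \<circ> f" "usc_envelope (upper \<circ> g) = upper \<circ> f"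
      using f lsc usc by (metis antisym lsc_envelope_mono, metis antisym usc_envelope_mono)
    then show "\<forall>x. graph_completion g x = f x"
      by (simp add: graph_completion_eq_iff)
  qed
qed

lemma hausdorff_continuous_lsc_lower:
  "hausdorff_continuous f \<Longrightarrow> lsc_envelope (lower \<circ> f) = lower \<circ> f"
  by (metis hausdorff_continuous_iff lsc_envelope_idem)

lemma fun_interval_le_iff:
  "f \<le>\<^sub>F g \<longleftrightarrow> lower \<circ> f \<le> lower \<circ> g \<and> upper \<circ> f \<le> upper \<circ> g"
  by (auto simp: fun_interval_le_def interval_le_def le_fun_def)

lemma set_of_subset_reals_iff:
  "set_of a \<subseteq> range ereal \<longleftrightarrow> - \<infinity> < lower a \<and> upper a < \<infinity>"
proof
  assume "set_of a \<subseteq> range ereal"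
  moreover have "lower a \<in> set_of a" "upper a \<in> set_of a"
    by (auto simp: set_of_eq)
  ultimately show "- \<infinity> < lower a \<and> upper a < \<infinity>"
    by fastforce
next
  assume a: "- \<infinity> < lower a \<and> upper a < \<infinity>"
  show "set_of a \<subseteq> range ereal"
  proof
    fix z assume "z \<in> set_of a"
    with a show "z \<in> range ereal"
      by (cases z) (auto simp: set_of_eq)
  qed
qed

section \<open>Suprema of H-continuous functions\<close>

text \<open>
  Completing \<open>S \<phi>\<close> to \<open>F (S \<phi>)\<close> gives exactly \<open>[I (S \<phi>), S \<phi>]\<close>, because \<open>S (S \<phi>) = S \<phi>\<close>.
\<close>

definition hausdorff_sup ::
    "('a::topological_space \<Rightarrow> ereal interval) set \<Rightarrow> 'a \<Rightarrow> ereal interval" where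
  "hausdorff_sup \<F> =
    graph_completion (\<lambda>x. interval_of (usc_envelope (SUP f\<in>\<F>. lower \<circ> f) x))"

lemma lower_hausdorff_sup:
  "lower \<circ> hausdorff_sup \<F> = lsc_envelope (usc_envelope (SUP f\<in>\<F>. lower \<circ> f))"
  by (simp add: hausdorff_sup_def comp_def lower_baire_eq_lsc_envelope)

lemma upper_hausdorff_sup:
  "upper \<circ> hausdorff_sup \<F> = usc_envelope (SUP f\<in>\<F>. lower \<circ> f)"
  by (simp add: hausdorff_sup_def comp_def upper_baire_eq_usc_envelope usc_envelope_idem)

lemma lsc_envelope_SUP_lower:
  assumes "\<forall>f\<in>\<F>. hausdorff_continuous f"
  shows "lsc_envelope (SUP f\<in>\<F>. lower \<circ> f) = (SUP f\<in>\<F>. lower \<circ> f)"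
  using assms by (intro lsc_envelope_SUP hausdorff_continuous_lsc_lower) auto

lemma hausdorff_continuous_hausdorff_sup:
  assumes "\<forall>f\<in>\<F>. hausdorff_continuous f"
  shows "hausdorff_continuous (hausdorff_sup \<F>)"
  unfolding hausdorff_continuous_iff lower_hausdorff_sup upper_hausdorff_sup
  using usc_lsc_usc_envelope[OF lsc_envelope_SUP_lower[OF assms]] by simp

lemma hausdorff_sup_upper:
  assumes \<F>: "\<forall>f\<in>\<F>. hausdorff_continuous f" and f: "f \<in> \<F>"
  shows "f \<le>\<^sub>F hausdorff_sup \<F>"
  unfolding fun_interval_le_iff
proof
  let ?\<phi> = "SUP f\<in>\<F>. lower \<circ> f"
  have le: "lower \<circ> f \<le> ?\<phi>"
    using f by (rule SUP_upper)
  also have "\<dots> \<le> lower \<circ> hausdorff_sup \<F>"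
    using lsc_envelope_mono[OF usc_envelope_ge[of ?\<phi>]]
    by (simp only: lower_hausdorff_sup lsc_envelope_SUP_lower[OF \<F>])
  finally show "lower \<circ> f \<le> lower \<circ> hausdorff_sup \<F>" .
  show "upper \<circ> f \<le> upper \<circ> hausdorff_sup \<F>"
    using usc_envelope_mono[OF le] \<F> f
    by (simp add: hausdorff_continuous_iff upper_hausdorff_sup)
qed

lemma hausdorff_sup_least:
  assumes g: "hausdorff_continuous g" and ub: "\<forall>f\<in>\<F>. f \<le>\<^sub>F g"
  shows "hausdorff_sup \<F> \<le>\<^sub>F g"
  unfolding fun_interval_le_iff
proof
  have "(SUP f\<in>\<F>. lower \<circ> f) \<le> lower \<circ> g"
    using ub by (intro SUP_least) (simp add: fun_interval_le_iff)
  then show *: "upper \<circ> hausdorff_sup \<F> \<le> upper \<circ> g"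
    using usc_envelope_mono g by (metis hausdorff_continuous_iff upper_hausdorff_sup)
  show "lower \<circ> hausdorff_sup \<F> \<le> lower \<circ> g"
    using lsc_envelope_mono[OF *] g
    by (simp add: hausdorff_continuous_iff lower_hausdorff_sup upper_hausdorff_sup)
qed

theorem theorem5:
  fixes \<F> :: "('a::topological_space \<Rightarrow> ereal interval) set"
  assumes "\<F> \<subseteq> \<H>\<^sub>f\<^sub>t"
    and "\<F> \<noteq> {}"
    and "\<exists>\<psi>\<in>\<H>\<^sub>f\<^sub>t. \<forall>f\<in>\<F>. f \<le>\<^sub>F \<psi>"
  shows "\<exists>u\<in>\<H>\<^sub>f\<^sub>t. is_lub \<H>\<^sub>f\<^sub>t_order u \<F>"
proof (rule bexI)
  let ?u = "hausdorff_sup \<F>"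
  have \<F>: "\<forall>f\<in>\<F>. hausdorff_continuous f"
    using assms(1) by (auto simp: finite_hausdorff_continuous_def)
  obtain \<psi> where \<psi>: "\<psi> \<in> \<H>\<^sub>f\<^sub>t" "\<forall>f\<in>\<F>. f \<le>\<^sub>F \<psi>"
    using assms(3) by blast
  obtain f where f: "f \<in> \<F>"
    using assms(2) by blast
  have "set_of (?u x) \<subseteq> range ereal" for x
  proof -
    have "- \<infinity> < lower (f x)" "upper (\<psi> x) < \<infinity>"
      using f \<psi>(1) assms(1) unfolding finite_hausdorff_continuous_def set_of_subset_reals_iff
      by blast+
    moreover have "lower (f x) \<le> lower (?u x)"
      using hausdorff_sup_upper[OF \<F> f] by (simp add: fun_interval_le_def interval_le_def)
    moreover have "upper (?u x) \<le> upper (\<psi> x)"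
      using hausdorff_sup_least[of \<psi> \<F>] \<psi>
      by (simp add: fun_interval_le_def interval_le_def finite_hausdorff_continuous_def)
    ultimately show ?thesis
      unfolding set_of_subset_reals_iff by (meson less_le_trans le_less_trans)
  qed
  then show u: "?u \<in> \<H>\<^sub>f\<^sub>t"
    using hausdorff_continuous_hausdorff_sup[OF \<F>]
    by (simp add: finite_hausdorff_continuous_def)
  have "?u \<le>\<^sub>F g" if "g \<in> \<H>\<^sub>f\<^sub>t" "\<forall>f\<in>\<F>. f \<le>\<^sub>F g" for g
    using that by (intro hausdorff_sup_least) (simp_all add: finite_hausdorff_continuous_def)
  then show "is_lub \<H>\<^sub>f\<^sub>t_order ?u \<F>"
    using u assms(1) hausdorff_sup_upper[OF \<F>]
    by (auto simp: least_def Upper_def finite_hausdorff_continuous_order_def)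
qed

end
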